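(* Let $\Lambda$ be an ordered abelian group and let $(X,d)$ be a geodesic $\Lambda$-metric space. If $(X,d)$ satisfies axiom (3), then $(X,d)$ is uniquely geodesic.
   Context: An ordered abelian group $(\Lambda,+)$ is an abelian group with a translation-invariant total order. A $\Lambda$-metric space is a set $X$ with a function $d\colon X\times X\to\Lambda$ that is positive definite ($d(x,y)\ge 0$, with equality iff $x=y$), symmetric and satisfies the triangle inequality. A closed $\Lambda$-interval is a set $[a,b]=\{\lambda\in\Lambda : a\le\lambda\le b\}$ with $a\le b$ in $\Lambda$, equipped with the $\Lambda$-metric $d_\Lambda(t,t')=|t'-t|$. A segment in $X$ is the image $s=\varphi([a,b])\subseteq X$ of an isometric embedding (distance-preserving map) $\varphi\colon[a,b]\to X$ of a closed $\Lambda$-interval; the endpoints of $s$ are $\varphi(a)$ and $\varphi(b)$ (the set of endpoints does not depend on $\varphi$). $X$ is geodesic if for any $p,q\in X$ there exists a segment with endpoints $p$ and $q$, and uniquely geodesic if for any $p,q\in X$ there is exactly one such segment (as a subset of $X$). Axiom (3): If two segments $s,s'\subseteq X$ have an endpoint in common, then their intersection $s\cap s'$ is a segment. *)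

theory Defs
  imports Main
begin

text \<open>
  An ordered abelian group is a type of sort
  \<open>{linordered_ab_group_add, ordered_ab_group_add_abs}\<close>.  The second class only provides
  the notation \<open>\<bar>x\<bar>\<close>: over a linear order its axioms force \<open>\<bar>x\<bar> = max x (- x)\<close>, so it does
  not restrict the group.
\<close>

locale Lambda_metric_space =
  fixes X :: "'a set"
    and d :: "'a \<Rightarrow> 'a \<Rightarrow> 'l::{linordered_ab_group_add, ordered_ab_group_add_abs}"
  assumes nonneg: "\<lbrakk>x \<in> X; y \<in> X\<rbrakk> \<Longrightarrow> 0 \<le> d x y"
    and zero: "\<lbrakk>x \<in> X; y \<in> X\<rbrakk> \<Longrightarrow> d x y = 0 \<longleftrightarrow> x = y"
    and commute: "\<lbrakk>x \<in> X; y \<in> X\<rbrakk> \<Longrightarrow> d x y = d y x"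
    and triangle: "\<lbrakk>x \<in> X; y \<in> X; z \<in> X\<rbrakk> \<Longrightarrow> d x z \<le> d x y + d y z"

definition isometric_embedding_Icc ::
    "'a set \<Rightarrow> ('a \<Rightarrow> 'a \<Rightarrow> 'l::{linordered_ab_group_add, ordered_ab_group_add_abs})
      \<Rightarrow> 'l \<Rightarrow> 'l \<Rightarrow> ('l \<Rightarrow> 'a) \<Rightarrow> bool"
  where "isometric_embedding_Icc X d a b \<phi> \<longleftrightarrow>
    a \<le> b \<and> \<phi> ` {a..b} \<subseteq> X \<and> (\<forall>t\<in>{a..b}. \<forall>t'\<in>{a..b}. d (\<phi> t) (\<phi> t') = \<bar>t' - t\<bar>)"

text \<open>
  Endpoints form an unordered pair.  Degenerate intervals \<open>{a..a}\<close> are allowed, so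
  singletons of points of \<open>X\<close> are segments, while the empty set is not.
\<close>

definition segment_with_endpoints ::
    "'a set \<Rightarrow> ('a \<Rightarrow> 'a \<Rightarrow> 'l::{linordered_ab_group_add, ordered_ab_group_add_abs})
      \<Rightarrow> 'a \<Rightarrow> 'a \<Rightarrow> 'a set \<Rightarrow> bool"
  where "segment_with_endpoints X d p q s \<longleftrightarrow>
    (\<exists>a b \<phi>. isometric_embedding_Icc X d a b \<phi> \<and> s = \<phi> ` {a..b} \<and> {\<phi> a, \<phi> b} = {p, q})"

definition is_segment ::
    "'a set \<Rightarrow> ('a \<Rightarrow> 'a \<Rightarrow> 'l::{linordered_ab_group_add, ordered_ab_group_add_abs})
      \<Rightarrow> 'a set \<Rightarrow> bool"
  where "is_segment X d s \<longleftrightarrow>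
    (\<exists>a b \<phi>. isometric_embedding_Icc X d a b \<phi> \<and> s = \<phi> ` {a..b})"

definition endpoints ::
    "'a set \<Rightarrow> ('a \<Rightarrow> 'a \<Rightarrow> 'l::{linordered_ab_group_add, ordered_ab_group_add_abs})
      \<Rightarrow> 'a set \<Rightarrow> 'a set"
  where "endpoints X d s = {p. \<exists>q. segment_with_endpoints X d p q s}"

definition geodesic ::
    "'a set \<Rightarrow> ('a \<Rightarrow> 'a \<Rightarrow> 'l::{linordered_ab_group_add, ordered_ab_group_add_abs}) \<Rightarrow> bool"
  where "geodesic X d \<longleftrightarrow> (\<forall>p\<in>X. \<forall>q\<in>X. \<exists>s. segment_with_endpoints X d p q s)"

definition uniquely_geodesic ::
    "'a set \<Rightarrow> ('a \<Rightarrow> 'a \<Rightarrow> 'l::{linordered_ab_group_add, ordered_ab_group_add_abs}) \<Rightarrow> bool"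
  where "uniquely_geodesic X d \<longleftrightarrow> (\<forall>p\<in>X. \<forall>q\<in>X. \<exists>!s. segment_with_endpoints X d p q s)"

definition segment_intersection_axiom ::
    "'a set \<Rightarrow> ('a \<Rightarrow> 'a \<Rightarrow> 'l::{linordered_ab_group_add, ordered_ab_group_add_abs}) \<Rightarrow> bool"
  where "segment_intersection_axiom X d \<longleftrightarrow>
    (\<forall>s s'. is_segment X d s \<and> is_segment X d s' \<and> endpoints X d s \<inter> endpoints X d s' \<noteq> {}
      \<longrightarrow> is_segment X d (s \<inter> s'))"

end

theory Submission
  imports Defs
begin

text \<open>
  If a segment \<open>u\<close> is contained in a segment \<open>s\<close> and contains both endpoints of \<open>s\<close>, then
  \<open>u = s\<close>: between these two endpoints, \<open>u\<close> has a point at every intermediate distance from the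
  first one, whereas \<open>s\<close> has only one such point.  Two segments with the same endpoints both
  contain their intersection in this way, so they coincide.
\<close>

lemma segment_with_endpoints_imp_is_segment:
  "segment_with_endpoints X d p q s \<Longrightarrow> is_segment X d s"
  unfolding segment_with_endpoints_def is_segment_def by blast

lemma segment_with_endpoints_mem:
  fixes d :: "'a \<Rightarrow> 'a \<Rightarrow> 'l::{linordered_ab_group_add, ordered_ab_group_add_abs}"
  assumes "segment_with_endpoints X d p q s"
  shows "p \<in> s" and "q \<in> s"
proof -
  obtain a b :: 'l and \<phi>
    where ab: "a \<le> b" and s: "s = \<phi> ` {a..b}" and ends: "{\<phi> a, \<phi> b} = {p, q}"
    using assms unfolding segment_with_endpoints_def isometric_embedding_Icc_def by blast
  \<comment> \<open>Endpoints are an unordered pair, so \<open>p\<close> may be either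
    \<open>\<phi> a\<close> or \<open>\<phi> b\<close>; arguing with the whole set avoids a case
    split.\<close>
  from ab have "{\<phi> a, \<phi> b} \<subseteq> s" unfolding s by simp
  then have "{p, q} \<subseteq> s" unfolding ends .
  then show "p \<in> s" and "q \<in> s" by auto
qed

lemma subsegment_with_endpoints_eq:
  assumes s: "segment_with_endpoints X d p q s"
    and u: "is_segment X d u" and sub: "u \<subseteq> s" and pq: "p \<in> u" "q \<in> u"
  shows "u = s"
proof
  obtain a b \<phi> where ab: "a \<le> b" and s_eq: "s = \<phi> ` {a..b}" and ends: "{\<phi> a, \<phi> b} = {p, q}"
    and \<phi>: "\<And>t t'. t \<in> {a..b} \<Longrightarrow> t' \<in> {a..b} \<Longrightarrow> d (\<phi> t) (\<phi> t') = \<bar>t' - t\<bar>"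
    using s unfolding segment_with_endpoints_def isometric_embedding_Icc_def by blast
  obtain c e \<psi> where u_eq: "u = \<psi> ` {c..e}"
    and \<psi>: "\<And>t t'. t \<in> {c..e} \<Longrightarrow> t' \<in> {c..e} \<Longrightarrow> d (\<psi> t) (\<psi> t') = \<bar>t' - t\<bar>"
    using u unfolding is_segment_def isometric_embedding_Icc_def by blast
  have "{\<phi> a, \<phi> b} \<subseteq> u"
    unfolding ends using pq by simp
  then obtain i j where i: "i \<in> {c..e}" "\<phi> a = \<psi> i" and j: "j \<in> {c..e}" "\<phi> b = \<psi> j"
    unfolding u_eq by blast
  \<comment> \<open>Both sides are the distance from \<open>\<phi> a\<close> to
    \<open>\<phi> b\<close>, measured once along \<open>u\<close> and once along
    \<open>s\<close>.\<close>
  have dist: "\<bar>j - i\<bar> = b - a"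
    using \<phi>[of a b] \<psi>[of i j] i j ab by simp
  show "s \<subseteq> u"
  proof
    fix x assume "x \<in> s"
    then obtain t where t: "t \<in> {a..b}" "x = \<phi> t" unfolding s_eq by blast
    \<comment> \<open>Walk the distance \<open>t - a\<close> from \<open>i\<close> towards
      \<open>j\<close>. Since \<open>t - a\<close> is at most \<open>b - a\<close>,
      \<open>dist\<close> prevents overshooting \<open>j\<close>, so the walk stays in
      \<open>{c..e}\<close>. The cases arise because \<open>\<psi>\<close> may traverse
      \<open>u\<close> in either direction.\<close>
    have "\<exists>k\<in>{c..e}. \<bar>k - i\<bar> = t - a"
    proof (cases "i \<le> j")
      case True
      then have "i + (t - a) \<le> j"
        using dist t by (simp add: algebra_simps)
      then have "i + (t - a) \<in> {c..e}"
        using i(1) j(1) t(1) order_trans[of c i "i + (t - a)"] order_trans[of "i + (t - a)" j e]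
        by simp
      then show ?thesis
        using t by (intro bexI[of _ "i + (t - a)"]) auto
    next
      case False
      then have "j \<le> i - (t - a)"
        using dist t by (simp add: algebra_simps)
      then have "i - (t - a) \<in> {c..e}"
        using i(1) j(1) t(1) order_trans[of "i - (t - a)" i e] order_trans[of c j "i - (t - a)"]
        by simp
      then show ?thesis
        using t by (intro bexI[of _ "i - (t - a)"]) (auto simp: abs_minus_commute)
    qed
    then obtain k where k: "k \<in> {c..e}" "\<bar>k - i\<bar> = t - a" by blast
    then have "\<psi> k \<in> s" using sub unfolding u_eq by blast
    then obtain r where r: "r \<in> {a..b}" "\<psi> k = \<phi> r" unfolding s_eq by blast
    \<comment> \<open>Both sides are the distance from \<open>\<phi> a\<close> to
      \<open>\<psi> k\<close>. As \<open>a\<close> is the left end of the interval, no absolute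
      value remains and the distance determines the parameter, so \<open>r = t\<close>.\<close>
    have "r - a = t - a"
      using \<phi>[of a r] \<psi>[of i k] i k r ab by simp
    then have "x = \<psi> k" using t r by simp
    then show "x \<in> u" using k unfolding u_eq by blast
  qed
qed (fact sub)

theorem proposition1:
  fixes X :: "'a set"
    and d :: "'a \<Rightarrow> 'a \<Rightarrow> 'l::{linordered_ab_group_add, ordered_ab_group_add_abs}"
  assumes "Lambda_metric_space X d"
    and "geodesic X d"
    and "segment_intersection_axiom X d"
  shows "uniquely_geodesic X d"
proof -
  have "s = s'"
    if s: "segment_with_endpoints X d p q s" and s': "segment_with_endpoints X d p q s'"
    for p q s s'
  proof -
    \<comment> \<open>One shared endpoint suffices to apply the axiom; \<open>q\<close> enters only
      through membership in the intersection.\<close>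
    have "p \<in> endpoints X d s \<inter> endpoints X d s'"
      using s s' unfolding endpoints_def by blast
    then have seg: "is_segment X d (s \<inter> s')"
      using assms(3) segment_with_endpoints_imp_is_segment[OF s]
        segment_with_endpoints_imp_is_segment[OF s']
      unfolding segment_intersection_axiom_def by (metis empty_iff)
    have mem: "p \<in> s \<inter> s'" "q \<in> s \<inter> s'"
      using segment_with_endpoints_mem[OF s] segment_with_endpoints_mem[OF s'] by simp_all
    have "s \<inter> s' = s"
      by (rule subsegment_with_endpoints_eq[OF s seg Int_lower1 mem])
    moreover have "s \<inter> s' = s'"
      by (rule subsegment_with_endpoints_eq[OF s' seg Int_lower2 mem])
    ultimately show ?thesis by simp
  qed
  then show ?thesis
    \<comment> \<open>Existence is geodesicity; uniqueness is the equality just shown.\<close>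
    using assms(2) unfolding geodesic_def uniquely_geodesic_def by metis
qed

end
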